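(* The property ``not having an isolated vertex'' has threshold $\frac{\log(n)}{n^2}$ in $\mathbb{G}(n,p\, ; \,\binom{[n]}{3})$; that is, \[ \lim_{n\to\infty}\mathbb{P}\left(\mathbb{G}\left(n,p_n\,;\,\binom{[n]}{3}\right)\text{ has no isolated vertex}\right)=\begin{cases}0,& \text{if } p_n\ll \frac{\log n}{n^2},\\ 1,&\text{if } p_n\gg \frac{\log n}{n^2}.\end{cases} \]
   Context: $\binom{[n]}{3}$ denotes the collection of all 3-element subsets of $[n]=\{1,\dots,n\}$. For $p\in[0,1]$, the random multigraph $\mathbb{G}(n,p\,;\,\binom{[n]}{3})$ is generated as follows: start with the empty graph on vertex set $[n]$; for every $H\in\binom{[n]}{3}$, choose a 2-element subset $\{i,j\}\subset H$ uniformly at random and then add an edge between $i$ and $j$ with probability $p$; all choices and coin flips are mutually independent. A vertex is isolated if no edge is incident to it. $a_n\ll b_n$ (equivalently $b_n\gg a_n$) means $a_n/b_n\to 0$. *)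

theory Defs
  imports "HOL-Probability.Probability" "HOL-Library.Landau_Symbols"
begin

text \<open>A (loopless) multigraph is a vertex set together with a multiset of edges, each edge being
  the set of its two endpoints.\<close>

type_synonym multigraph = "nat set \<times> nat set multiset"

definition isolated_vertex :: "multigraph \<Rightarrow> nat \<Rightarrow> bool" where
  "isolated_vertex G v \<longleftrightarrow> v \<in> fst G \<and> (\<forall>e \<in># snd G. v \<notin> e)"

definition has_no_isolated_vertex :: "multigraph \<Rightarrow> bool" where
  "has_no_isolated_vertex G \<longleftrightarrow> \<not> (\<exists>v. isolated_vertex G v)"

definition subsets_of_card :: "nat \<Rightarrow> nat set \<Rightarrow> nat set set" where
  "subsets_of_card k A = {B. B \<subseteq> A \<and> card B = k}"

text \<open>The contribution of a single set \<open>H\<close> to the random multigraph: \<open>Some e\<close> if the edge \<open>e\<close> is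
  added, \<open>None\<close> if no edge is added.\<close>

definition random_edge :: "real \<Rightarrow> nat set \<Rightarrow> nat set option pmf" where
  "random_edge p H = do {
     e \<leftarrow> pmf_of_set (subsets_of_card 2 H);
     b \<leftarrow> bernoulli_pmf p;
     return_pmf (if b then Some e else None)
   }"

text \<open>The multigraph on \<open>{1..n}\<close> that contains one copy of \<open>e\<close> for every \<open>H \<in> \<H>\<close> with
  \<open>c H = Some e\<close>; different sets \<open>H\<close> may contribute parallel edges.\<close>

definition multigraph_of_choices ::
    "nat \<Rightarrow> nat set set \<Rightarrow> (nat set \<Rightarrow> nat set option) \<Rightarrow> multigraph" where
  "multigraph_of_choices n \<H> c =
     ({1..n}, image_mset (\<lambda>H. the (c H)) (mset_set {H \<in> \<H>. c H \<noteq> None}))"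

text \<open>The model \<open>G(n,p;\<H>)\<close> for a finite collection \<open>\<H>\<close> of subsets of \<open>{1..n}\<close> with at least two
  elements each. The choices are independent since \<open>Pi_pmf\<close> is the product distribution.\<close>

definition random_multigraph :: "nat \<Rightarrow> real \<Rightarrow> nat set set \<Rightarrow> multigraph pmf" where
  "random_multigraph n p \<H> =
     map_pmf (multigraph_of_choices n \<H>) (Pi_pmf \<H> None (random_edge p))"

end

theory Submission
  imports Defs "HOL-Real_Asymp.Real_Asymp"
begin

text \<open>A vertex is isolated with probability \<open>(1 - 2p/3)^((n-1) choose 2)\<close>, so the expected number
  \<open>\<mu>\<close> of isolated vertices tends to 0 above the threshold, where the union bound suffices.
  Below the threshold \<open>\<mu>\<close> tends to infinity and the second moment method applies: a triple that
  contains at most one of two vertices contributes independently to their isolation, and a triple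
  that contains both contributes the factor \<open>1 - p \<le> (1 - 2p/3)^2 (1 + p)\<close>. Hence the joint
  probability of two isolation events exceeds the product of their probabilities by a factor of at
  most \<open>(1 + p)^n\<close>, which tends to 1.\<close>

section \<open>Second moment bound for the probability that no event of a finite family
  occurs\<close>

text \<open>Chebyshev's argument for the number \<open>X\<close> of events that occur, with mean
  \<open>\<mu>\<close>: if none occurs, \<open>X\<close> deviates from its mean by all of
  \<open>\<mu>\<close>, while its variance is at most
  \<open>\<mu> + (R - 1) * \<mu>\<^sup>2\<close>.\<close>

lemma (in prob_space) second_moment_prob_none_le:
  fixes A :: "'v \<Rightarrow> 'a set"
  assumes V: "finite V" and A: "\<And>v. v \<in> V \<Longrightarrow> A v \<in> events"
    and R: "0 \<le> R"
    and pair: "\<And>u v. u \<in> V \<Longrightarrow> v \<in> V \<Longrightarrow> u \<noteq> v \<Longrightarrow> prob (A u \<inter> A v) \<le> R * (prob (A u) * prob (A v))"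
    and pos: "0 < (\<Sum>v\<in>V. prob (A v))"
  shows "prob (space M - (\<Union>v\<in>V. A v)) \<le> 1 / (\<Sum>v\<in>V. prob (A v)) + (R - 1)"
proof -
  define \<mu> where "\<mu> = (\<Sum>v\<in>V. prob (A v))"
  define X where "X = (\<lambda>x. \<Sum>v\<in>V. indicator (A v) x :: real)"
  let ?Z = "space M - (\<Union>v\<in>V. A v)"
  have int1: "integrable M (indicator (A v) :: _ \<Rightarrow> real)" if "v \<in> V" for v
    using A[OF that] by (simp add: emeasure_eq_measure)
  have int2: "integrable M (indicator (A u \<inter> A v) :: _ \<Rightarrow> real)" if "u \<in> V" "v \<in> V" for u v
    using A[OF that(1)] A[OF that(2)] by (intro integrable_real_indicator) (auto simp: emeasure_eq_measure)
  have Z: "?Z \<in> events" using V A by auto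
  have X2: "(X x)\<^sup>2 = (\<Sum>u\<in>V. \<Sum>v\<in>V. indicator (A u \<inter> A v) x)" for x
    by (simp add: X_def power2_eq_square sum_product indicator_inter_arith)
  have iX: "integrable M X" unfolding X_def using int1 by auto
  have iX2: "integrable M (\<lambda>x. (X x)\<^sup>2)" unfolding X2 using int2 by auto
  have EX: "expectation X = \<mu>"
    unfolding X_def \<mu>_def using int1 A by (subst Bochner_Integration.integral_sum) (auto intro!: sum.cong simp: sets.Int_space_eq2)
  have "expectation (\<lambda>x. (X x)\<^sup>2) = (\<Sum>u\<in>V. \<Sum>v\<in>V. prob (A u \<inter> A v))"
    unfolding X2 using int2 A
    by (simp add: Bochner_Integration.integral_sum sets.Int_space_eq2 cong: sum.cong)
  \<comment> \<open>On the diagonal the intersection is \<open>A u\<close> itself. The term with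
    \<open>R\<close> is added there too, which is an upper bound because \<open>R\<close> is
    nonnegative and lets the double sum factor.\<close>
  also have "\<dots> \<le> (\<Sum>u\<in>V. \<Sum>v\<in>V. (if u = v then prob (A u) else 0) + R * (prob (A u) * prob (A v)))"
    using pair R by (intro sum_mono) auto
  also have "\<dots> = \<mu> + R * \<mu>\<^sup>2"
    unfolding \<mu>_def power2_eq_square sum_product sum.distrib
    using V by (simp add: sum_distrib_left)
  finally have EX2: "expectation (\<lambda>x. (X x)\<^sup>2) \<le> \<mu> + R * \<mu>\<^sup>2" .
  have eq: "(X x - \<mu>)\<^sup>2 = (X x)\<^sup>2 - 2 * \<mu> * X x + \<mu>\<^sup>2" for x
    by (simp add: power2_eq_square algebra_simps)
  have iD: "integrable M (\<lambda>x. (X x - \<mu>)\<^sup>2)"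
    unfolding eq using iX iX2 by auto
  have "\<mu>\<^sup>2 * prob ?Z = expectation (\<lambda>x. \<mu>\<^sup>2 * indicator ?Z x)"
    using Z by simp
  also have "\<dots> \<le> expectation (\<lambda>x. (X x - \<mu>)\<^sup>2)"
  proof (rule integral_mono)
    show "integrable M (\<lambda>x. \<mu>\<^sup>2 * indicator ?Z x)"
      using Z by (auto simp: emeasure_eq_measure)
    show "\<mu>\<^sup>2 * indicator ?Z x \<le> (X x - \<mu>)\<^sup>2" for x
      by (cases "x \<in> ?Z") (auto simp: X_def)
  qed (rule iD)
  also have "\<dots> = expectation (\<lambda>x. (X x)\<^sup>2) - 2 * \<mu> * \<mu> + \<mu>\<^sup>2"
    unfolding eq using iX iX2 EX by (simp add: prob_space)
  also have "\<dots> \<le> \<mu> + R * \<mu>\<^sup>2 - \<mu>\<^sup>2"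
    using EX2 by (simp add: power2_eq_square)
  also have "\<dots> = \<mu>\<^sup>2 * (1 / \<mu> + (R - 1))"
    using pos by (simp add: \<mu>_def[symmetric] power2_eq_square field_simps)
  finally show ?thesis
    using pos by (simp add: \<mu>_def[symmetric])
qed

section \<open>The contribution of a single set, and independence across triples\<close>

text \<open>\<open>None\<close> always belongs to this set. A set \<open>S\<close> in place of one
  vertex lets the isolation of one vertex and the joint isolation of two share one formula.\<close>

definition avoiding :: "nat set \<Rightarrow> nat set option set" where
  "avoiding S = {x. \<forall>e\<in>set_option x. e \<inter> S = {}}"

lemma finite_subsets_of_card [simp]: "finite A \<Longrightarrow> finite (subsets_of_card k A)"
  by (simp add: subsets_of_card_def)

lemma card_subsets_of_card: "finite A \<Longrightarrow> card (subsets_of_card k A) = card A choose k"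
  by (simp add: subsets_of_card_def n_subsets)

lemma measure_bind_pmf:
  "measure_pmf.prob (bind_pmf M f) X = measure_pmf.expectation M (\<lambda>x. measure_pmf.prob (f x) X)"
proof -
  \<comment> \<open>Pushing forward to truth values turns the probability of a set into a point
    mass, to which \<open>pmf_bind\<close> applies.\<close>
  have *: "measure_pmf.prob N X = pmf (map_pmf (\<lambda>y. y \<in> X) N) True" for N
    by (simp add: pmf_map vimage_def)
  show ?thesis by (simp only: * map_bind_pmf pmf_bind)
qed

text \<open>Either the coin fails, or it succeeds and the uniformly chosen pair lies inside
  \<open>H - S\<close>.\<close>

lemma prob_random_edge_avoiding:
  assumes H: "finite H" "2 \<le> card H" and p: "0 \<le> p" "p \<le> 1"
  shows "measure_pmf.prob (random_edge p H) (avoiding S) =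
         1 - p + p * (card (H - S) choose 2) / (card H choose 2)"
proof -
  let ?P = "subsets_of_card 2 H"
  have card: "card ?P = card H choose 2" using H by (simp add: card_subsets_of_card)
  have fin: "finite ?P" using H by simp
  have ne: "?P \<noteq> {}"
    using card H(2) by (metis card.empty binomial_eq_0_iff not_le)
  have inter: "?P \<inter> {e. e \<inter> S = {}} = subsets_of_card 2 (H - S)"
    by (auto simp: subsets_of_card_def)
  have *: "measure_pmf.prob (bernoulli_pmf p \<bind> (\<lambda>b. return_pmf (if b then Some e else None))) (avoiding S)
     = 1 - p + p * indicator {e. e \<inter> S = {}} e" for e
    using p by (simp add: measure_bind_pmf avoiding_def indicator_def)
  have "measure_pmf.prob (random_edge p H) (avoiding S) =
     measure_pmf.expectation (pmf_of_set ?P) (\<lambda>e. 1 - p + p * indicator {e. e \<inter> S = {}} e)"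
    unfolding random_edge_def * [symmetric] by (rule measure_bind_pmf)
  also have "\<dots> = 1 - p + p * measure_pmf.prob (pmf_of_set ?P) {e. e \<inter> S = {}}"
  proof -
    have "integrable (measure_pmf (pmf_of_set ?P)) (\<lambda>e. p * indicator {e. e \<inter> S = {}} e)"
      by (intro integrable_mult_right integrable_real_indicator) (simp_all add: measure_pmf.emeasure_eq_measure)
    then show ?thesis by (simp add: measure_pmf.prob_space)
  qed
  also have "measure_pmf.prob (pmf_of_set ?P) {e. e \<inter> S = {}} = (card (H - S) choose 2) / (card H choose 2)"
    using ne fin H by (simp add: measure_pmf_of_set inter card card_subsets_of_card)
  finally show ?thesis by simp
qed

lemma three_choose_two: "(3::nat) choose 2 = 3"
  by (simp add: numeral_eq_Suc)

text \<open>The choices are independent and the event restricts each coordinate separately, so its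
  probability is a product.\<close>

lemma prob_all_avoiding:
  assumes fin: "finite \<H>" and c: "\<And>H. H \<in> \<H> \<Longrightarrow> card H = 3" and p: "0 \<le> p" "p \<le> 1"
  shows "measure_pmf.prob (Pi_pmf \<H> None (random_edge p)) (Pi \<H> (\<lambda>_. avoiding S)) =
         (\<Prod>H\<in>\<H>. 1 - p + p * (card (H - S) choose 2) / 3)"
proof -
  have "measure_pmf.prob (random_edge p H) (avoiding S) = 1 - p + p * (card (H - S) choose 2) / 3"
    if "H \<in> \<H>" for H
    \<comment> \<open>Finiteness of \<open>H\<close> comes from \<open>card.infinite\<close>: an
      infinite set would have cardinality 0, not 3.\<close>
    using prob_random_edge_avoiding[of H p S] c[OF that] p three_choose_two card.infinite[of H] by fastforce
  with fin show ?thesis by (simp add: measure_Pi_pmf_Pi)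
qed

section \<open>Counting triples through one or two vertices\<close>

text \<open>Remove the triples that miss \<open>v\<close> from all triples and apply Pascal's
  rule.\<close>

lemma card_triples_containing:
  assumes "v \<in> {1..n}"
  shows "card {H \<in> subsets_of_card 3 {1..n}. v \<in> H} = (n - 1) choose 2"
proof -
  let ?T = "subsets_of_card 3 {1..n}"
  have "{H \<in> ?T. v \<in> H} = ?T - subsets_of_card 3 ({1..n} - {v})"
    by (auto simp: subsets_of_card_def)
  moreover have "subsets_of_card 3 ({1..n} - {v}) \<subseteq> ?T"
    by (auto simp: subsets_of_card_def)
  ultimately have "card {H \<in> ?T. v \<in> H} = (n choose 3) - ((n - 1) choose 3)"
    using assms by (simp add: card_Diff_subset card_subsets_of_card)
  also have "\<dots> = (n - 1) choose 2"
    using assms by (cases n) (simp_all add: numeral_eq_Suc)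
  finally show ?thesis .
qed

text \<open>Such a triple is determined by its third element. The crude bound \<open>n\<close> is
  good enough, since \<open>n * p\<close> tends to 0 below the threshold.\<close>

lemma card_triples_containing_pair_le:
  assumes "u \<noteq> v"
  shows "card {H \<in> subsets_of_card 3 {1..n}. u \<in> H \<and> v \<in> H} \<le> n"
proof -
  have "{H \<in> subsets_of_card 3 {1..n}. u \<in> H \<and> v \<in> H} \<subseteq> (\<lambda>w. {u, v, w}) ` {1..n}"
  proof
    fix H assume H: "H \<in> {H \<in> subsets_of_card 3 {1..n}. u \<in> H \<and> v \<in> H}"
    then have "{u, v} \<subseteq> H" "card H = 3" by (auto simp: subsets_of_card_def)
    then have "card (H - {u, v}) = 1" using assms by (simp add: card_Diff_subset)
    then obtain w where w: "H - {u, v} = {w}" by (auto simp: card_1_singleton_iff)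
    with \<open>{u, v} \<subseteq> H\<close> have "H = {u, v, w}" by blast
    moreover from H w have "w \<in> {1..n}" unfolding subsets_of_card_def by blast
    ultimately show "H \<in> (\<lambda>w. {u, v, w}) ` {1..n}" by blast
  qed
  then have "card {H \<in> subsets_of_card 3 {1..n}. u \<in> H \<and> v \<in> H} \<le> card {1..n}"
    by (meson card_image_le card_mono finite_atLeastAtMost finite_imageI le_trans)
  then show ?thesis by simp
qed

section \<open>Isolation events and their probabilities\<close>

text \<open>Stated for choice functions rather than multigraphs, which keeps the product structure
  available.\<close>

definition isolation_event :: "nat \<Rightarrow> nat \<Rightarrow> (nat set \<Rightarrow> nat set option) set" where
  "isolation_event n v = Pi (subsets_of_card 3 {1..n}) (\<lambda>_. avoiding {v})"

abbreviation choices :: "nat \<Rightarrow> real \<Rightarrow> (nat set \<Rightarrow> nat set option) pmf" where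
  "choices n p \<equiv> Pi_pmf (subsets_of_card 3 {1..n}) None (random_edge p)"

lemma has_no_isolated_vertex_choices_iff:
  "has_no_isolated_vertex (multigraph_of_choices n (subsets_of_card 3 {1..n}) c) \<longleftrightarrow>
     c \<notin> (\<Union>v\<in>{1..n}. isolation_event n v)"
proof -
  let ?T = "subsets_of_card 3 {1..n}"
  have "isolated_vertex (multigraph_of_choices n ?T c) v \<longleftrightarrow>
      v \<in> {1..n} \<and> (\<forall>H\<in>?T. c H \<noteq> None \<longrightarrow> v \<notin> the (c H))" for v
    by (simp add: isolated_vertex_def multigraph_of_choices_def) blast
  moreover have "c \<in> isolation_event n v \<longleftrightarrow> (\<forall>H\<in>?T. c H \<noteq> None \<longrightarrow> v \<notin> the (c H))" for v
    by (simp add: isolation_event_def avoiding_def Pi_def elem_set) fastforce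
  ultimately have "isolated_vertex (multigraph_of_choices n ?T c) =
      (\<lambda>v. v \<in> {1..n} \<and> c \<in> isolation_event n v)"
    by (intro ext) simp
  then show ?thesis
    unfolding has_no_isolated_vertex_def by (simp only: UN_iff Bex_def)
qed

lemma prob_no_isolated_vertex:
  "measure_pmf.prob (random_multigraph n p (subsets_of_card 3 {1..n})) {G. has_no_isolated_vertex G} =
   measure_pmf.prob (choices n p) (UNIV - (\<Union>v\<in>{1..n}. isolation_event n v))"
  unfolding random_multigraph_def measure_map_pmf vimage_def mem_Collect_eq
    has_no_isolated_vertex_choices_iff
  by (simp only: Compl_eq[symmetric] Compl_eq_Diff_UNIV)

text \<open>Of the three pairs in a triple through \<open>v\<close>, only one misses
  \<open>v\<close>; in any other triple all three do.\<close>

lemma isolation_factor_single: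
  fixes p :: real
  assumes "card H = 3"
  shows "1 - p + p * (card (H - {v}) choose 2) / 3 = (if v \<in> H then 1 - 2 * p / 3 else 1)"
proof -
  have "card (H - {v}) = (if v \<in> H then 2 else 3)"
    using assms by (simp add: card_Diff_singleton_if)
  then show ?thesis by (simp add: three_choose_two)
qed

lemma prob_isolation_event:
  assumes v: "v \<in> {1..n}" and p: "0 \<le> p" "p \<le> 1"
  shows "measure_pmf.prob (choices n p) (isolation_event n v) = (1 - 2 * p / 3) ^ ((n - 1) choose 2)"
proof -
  let ?T = "subsets_of_card 3 {1..n}"
  have "measure_pmf.prob (choices n p) (isolation_event n v) =
      (\<Prod>H\<in>?T. if v \<in> H then 1 - 2 * p / 3 else 1)"
    unfolding isolation_event_def using p
    by (subst prob_all_avoiding)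
       (auto simp: subsets_of_card_def isolation_factor_single three_choose_two intro!: prod.cong)
  also have "\<dots> = (1 - 2 * p / 3) ^ card {H \<in> ?T. v \<in> H}"
    by (simp add: prod.If_cases Int_def)
  finally show ?thesis using card_triples_containing[OF v] by simp
qed

text \<open>If \<open>H\<close> misses one of the two vertices, that vertex has factor 1 and
  equality holds. If \<open>H\<close> contains both, every pair in \<open>H\<close> meets
  \<open>{u, v}\<close>, so the left side is \<open>1 - p\<close>.\<close>

lemma isolation_factor_pair:
  assumes H: "card H = 3" and p: "0 \<le> p" "p \<le> (1::real)" and "u \<noteq> v"
  shows "1 - p + p * (card (H - {u, v}) choose 2) / 3 \<le>
    (1 - p + p * (card (H - {u}) choose 2) / 3) * (1 - p + p * (card (H - {v}) choose 2) / 3)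
     * (if u \<in> H \<and> v \<in> H then 1 + p else 1)"
proof (cases "u \<in> H \<and> v \<in> H")
  case True
  have "card (H - {u, v}) = 1" using True H assms(4)
    by (subst card_Diff_subset) auto
  then have uv: "1 - p + p * (card (H - {u, v}) choose 2) / 3 = 1 - p"
    by simp
  \<comment> \<open>The difference is 2p/9 times 3 - 4p + 2p^2; completing the square makes its sign
    visible.\<close>
  have "(1 - 2 * p / 3) * (1 - 2 * p / 3) * (1 + p) - (1 - p) = 2 * p / 9 * (1 + 2 * (1 - p)\<^sup>2)"
    by (simp add: power2_eq_square field_simps)
  moreover have "0 \<le> 2 * p / 9 * (1 + 2 * (1 - p)\<^sup>2)" using p by simp
  ultimately have "1 - p \<le> (1 - 2 * p / 3) * (1 - 2 * p / 3) * (1 + p)" by linarith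
  then show ?thesis
    unfolding uv isolation_factor_single[OF H] using True by simp
next
  case False
  then consider "H - {u, v} = H - {u}" "H - {v} = H" | "H - {u, v} = H - {v}" "H - {u} = H" by auto
  then show ?thesis
  proof cases
    case 1
    show ?thesis unfolding 1 if_not_P[OF False] by (simp add: H three_choose_two)
  next
    case 2
    show ?thesis unfolding 2 if_not_P[OF False] by (simp add: H three_choose_two)
  qed
qed

text \<open>Multiply the bounds for single triples: the extra factor \<open>1 + p\<close> arises
  only from the at most \<open>n\<close> triples through both vertices.\<close>

lemma prob_isolation_event_pair_le:
  assumes p: "0 \<le> p" "p \<le> 1" and "u \<noteq> v"
  shows "measure_pmf.prob (choices n p) (isolation_event n u \<inter> isolation_event n v) \<le>
    (1 + p) ^ n * (measure_pmf.prob (choices n p) (isolation_event n u) *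
      measure_pmf.prob (choices n p) (isolation_event n v))"
proof -
  let ?T = "subsets_of_card 3 {1..n}"
  let ?f = "\<lambda>S H. 1 - p + p * real (card (H - S) choose 2) / 3"
  let ?P = "measure_pmf.prob (choices n p)"
  have eq: "?P (Pi ?T (\<lambda>_. avoiding S)) = (\<Prod>H\<in>?T. ?f S H)" for S
    using p by (intro prob_all_avoiding) (auto simp: subsets_of_card_def)
  have "isolation_event n u \<inter> isolation_event n v = Pi ?T (\<lambda>_. avoiding {u, v})"
    by (auto simp: isolation_event_def avoiding_def Pi_def)
  then have "?P (isolation_event n u \<inter> isolation_event n v) = (\<Prod>H\<in>?T. ?f {u, v} H)"
    by (simp only: eq)
  also have "\<dots> \<le> (\<Prod>H\<in>?T. ?f {u} H * ?f {v} H * (if u \<in> H \<and> v \<in> H then 1 + p else 1))"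
    using p assms(3) by (intro prod_mono conjI isolation_factor_pair) (auto simp: subsets_of_card_def)
  also have "\<dots> = ?P (isolation_event n u) * ?P (isolation_event n v) *
      (1 + p) ^ card {H \<in> ?T. u \<in> H \<and> v \<in> H}"
    unfolding isolation_event_def eq prod.distrib by (simp add: prod.If_cases Int_def)
  also have "\<dots> \<le> ?P (isolation_event n u) * ?P (isolation_event n v) * (1 + p) ^ n"
    using p card_triples_containing_pair_le[OF assms(3)]
    by (intro mult_left_mono power_increasing) auto
  finally show ?thesis by (simp add: mult_ac)
qed

section \<open>First and second moment bounds in the random multigraph\<close>

text \<open>A closed formula, so that the asymptotic estimates involve no probability space;
  \<open>sum_prob_isolation_event\<close> identifies it with the mean.\<close>

definition expected_isolated :: "nat \<Rightarrow> real \<Rightarrow> real" where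
  "expected_isolated n p = real n * (1 - 2 * p / 3) ^ ((n - 1) choose 2)"

lemma sum_prob_isolation_event:
  assumes "0 \<le> p" "p \<le> 1"
  shows "(\<Sum>v\<in>{1..n}. measure_pmf.prob (choices n p) (isolation_event n v)) = expected_isolated n p"
proof -
  have "(\<Sum>v\<in>{1..n}. measure_pmf.prob (choices n p) (isolation_event n v)) =
      (\<Sum>v\<in>{1..n}. (1 - 2 * p / 3) ^ ((n - 1) choose 2))"
    using assms by (intro sum.cong refl prob_isolation_event)
  then show ?thesis by (simp add: expected_isolated_def)
qed

text \<open>The second moment bound with \<open>R = (1 + p) ^ n\<close>. The mean is positive
  because \<open>1 - 2 * p / 3\<close> is at least 1/3.\<close>

lemma prob_no_isolated_vertex_le:
  assumes p: "0 \<le> p" "p \<le> 1" and n: "0 < n"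
  shows "measure_pmf.prob (random_multigraph n p (subsets_of_card 3 {1..n})) {G. has_no_isolated_vertex G}
    \<le> 1 / expected_isolated n p + ((1 + p) ^ n - 1)"
proof -
  note sum = sum_prob_isolation_event[OF p, of n]
  have "0 < expected_isolated n p" using n p by (simp add: expected_isolated_def)
  with p show ?thesis
    unfolding prob_no_isolated_vertex sum[symmetric]
    by (intro measure_pmf.second_moment_prob_none_le[where M = "choices n p", unfolded space_measure_pmf]
        prob_isolation_event_pair_le) (simp_all only: sum, auto)
qed

text \<open>The union bound over all vertices.\<close>

lemma prob_no_isolated_vertex_ge:
  assumes p: "0 \<le> p" "p \<le> 1"
  shows "1 - expected_isolated n p \<le>
    measure_pmf.prob (random_multigraph n p (subsets_of_card 3 {1..n})) {G. has_no_isolated_vertex G}"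
proof -
  let ?P = "measure_pmf.prob (choices n p)"
  have "?P (\<Union>v\<in>{1..n}. isolation_event n v) \<le> (\<Sum>v\<in>{1..n}. ?P (isolation_event n v))"
    by (intro measure_pmf.finite_measure_subadditive_finite) auto
  also have "\<dots> = expected_isolated n p"
    by (rule sum_prob_isolation_event[OF p])
  finally show ?thesis
    unfolding prob_no_isolated_vertex
    using measure_pmf.prob_compl[of "\<Union>v\<in>{1..n}. isolation_event n v" "choices n p"] by simp
qed

section \<open>Estimates for the expected number of isolated vertices\<close>

lemma exp_bound_one_minus:
  assumes "0 \<le> x" "x \<le> (1/2 :: real)"
  shows "exp (- 2 * x) \<le> 1 - x"
proof -
  have "- x - 2 * x\<^sup>2 \<le> ln (1 - x)" using assms by (rule ln_one_minus_pos_lower_bound)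
  moreover have "2 * x\<^sup>2 \<le> x" using mult_left_mono[OF assms(2,1)] by (simp add: power2_eq_square)
  ultimately have "- 2 * x \<le> ln (1 - x)" by simp
  then show ?thesis using assms by (subst (asm) ln_ge_iff) auto
qed

text \<open>The bound 3/4 makes \<open>2 * p / 3\<close> at most 1/2, as
  \<open>exp_bound_one_minus\<close> requires. With at most n^2/2 triples through a vertex, the
  isolation probability is at least exp(-2pn^2/3), hence at least n^(-1/3).\<close>

lemma expected_isolated_lower:
  assumes p: "0 \<le> p" "p \<le> 3/4" and small: "p * (real n)\<^sup>2 \<le> 1/2 * ln (real n)" and n: "0 < n"
  shows "real n powr (2/3) \<le> expected_isolated n p"
proof -
  have "2 * ((n - 1) choose 2) \<le> (n - 1) * (n - 1 - 1)"
    unfolding choose_two by (rule times_div_less_eq_dividend)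
  also have "\<dots> \<le> n\<^sup>2"
    unfolding power2_eq_square by (intro mult_le_mono) simp_all
  finally have "2 * ((n - 1) choose 2) \<le> n\<^sup>2" .
  then have N: "2 * real ((n - 1) choose 2) \<le> (real n)\<^sup>2"
    by (metis of_nat_le_iff of_nat_mult of_nat_numeral of_nat_power)
  have "- (1/3) * ln (real n) \<le> real ((n - 1) choose 2) * (- 2 * (2 * p / 3))"
    using mult_left_mono[OF N p(1)] small by (simp add: field_simps)
  then have "exp (- (1/3) * ln (real n)) \<le> exp (- 2 * (2 * p / 3)) ^ ((n - 1) choose 2)"
    by (simp only: exp_of_nat_mult[symmetric] exp_le_cancel_iff)
  also have "\<dots> \<le> (1 - 2 * p / 3) ^ ((n - 1) choose 2)"
    using p by (intro power_mono exp_bound_one_minus) auto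
  finally have "real n * exp (- (1/3) * ln (real n)) \<le> expected_isolated n p"
    unfolding expected_isolated_def by (intro mult_left_mono) auto
  moreover have "real n * exp (- (1/3) * ln (real n)) = real n powr (2/3)"
    using n powr_add[of "real n" 1 "-1/3"] by (simp add: powr_def)
  ultimately show ?thesis by simp
qed

text \<open>At least n^2/4 triples pass through a vertex, so the isolation probability is at most
  exp(-pn^2/6). The constant 12 turns this into n^(-2).\<close>

lemma expected_isolated_upper:
  assumes p: "0 \<le> p" "p \<le> 1" and large: "12 * ln (real n) \<le> p * (real n)\<^sup>2" and n: "6 \<le> n"
  shows "expected_isolated n p \<le> 1 / real n"
proof -
  have "4 * real ((n - 1) choose 2) = 2 * ((real n - 1) * (real n - 2))"
    using n by (simp add: choose_two real_of_nat_div of_nat_diff)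
  \<comment> \<open>Needed because 2(n-1)(n-2) - n^2 = n(n-6) + 4; this is the source of the bound
    6.\<close>
  moreover have "0 \<le> real n * (real n - 6)" using n by simp
  ultimately have N: "(real n)\<^sup>2 \<le> 4 * real ((n - 1) choose 2)"
    by (simp add: power2_eq_square algebra_simps)
  have "(1 - 2 * p / 3) ^ ((n - 1) choose 2) \<le> exp (- (2 * p / 3)) ^ ((n - 1) choose 2)"
    using p exp_ge_add_one_self[of "- (2 * p / 3)"] by (intro power_mono) auto
  also have "\<dots> \<le> exp (- 2 * ln (real n))"
    using mult_left_mono[OF N p(1)] large
    by (simp only: exp_of_nat_mult[symmetric] exp_le_cancel_iff) (simp add: field_simps)
  finally have "expected_isolated n p \<le> real n * exp (- 2 * ln (real n))"
    unfolding expected_isolated_def by (intro mult_left_mono) auto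
  also have "exp (- 2 * ln (real n)) = real n powr (-2)" using n by (simp add: powr_def)
  also have "real n * real n powr (-2) = 1 / real n"
    using n by (simp add: powr_minus power2_eq_square field_simps)
  finally show ?thesis .
qed

section \<open>Passage to the limit on both sides of the threshold\<close>

theorem theorem6p2:
  fixes p :: "nat \<Rightarrow> real"
  assumes "\<And>n. 0 \<le> p n \<and> p n \<le> 1"
  shows "(p \<in> o(\<lambda>n. ln (real n) / (real n)\<^sup>2) \<longrightarrow>
            (\<lambda>n. measure_pmf.prob (random_multigraph n (p n) (subsets_of_card 3 {1..n}))
                   {G. has_no_isolated_vertex G}) \<longlonglongrightarrow> 0)
       \<and> ((\<lambda>n. ln (real n) / (real n)\<^sup>2) \<in> o(p) \<longrightarrow>
            (\<lambda>n. measure_pmf.prob (random_multigraph n (p n) (subsets_of_card 3 {1..n}))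
                   {G. has_no_isolated_vertex G}) \<longlonglongrightarrow> 1)"
proof (intro conjI impI)
  let ?P = "\<lambda>n. measure_pmf.prob (random_multigraph n (p n) (subsets_of_card 3 {1..n}))
                   {G. has_no_isolated_vertex G}"
  have p: "0 \<le> p n" "p n \<le> 1" for n using assms by auto
  {
    assume "p \<in> o(\<lambda>n. ln (real n) / (real n)\<^sup>2)"
    \<comment> \<open>The constant 1/2 is the one in \<open>expected_isolated_lower\<close>.\<close>
    then have "\<forall>\<^sub>F n in sequentially. norm (p n) \<le> 1/2 * norm (ln (real n) / (real n)\<^sup>2)"
      by (rule landau_o.smallD) simp
    then have small: "\<forall>\<^sub>F n in sequentially. p n * (real n)\<^sup>2 \<le> 1/2 * ln (real n)"
      using eventually_gt_at_top[of 0]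
      by eventually_elim (use p in \<open>simp add: field_simps\<close>)
    \<comment> \<open>Combined with \<open>small\<close>, this forces \<open>p n \<le> 3/4\<close>
      eventually.\<close>
    have log: "\<forall>\<^sub>F n in sequentially. 1/2 * ln (real n) \<le> 3/4 * (real n)\<^sup>2"
      by real_asymp
    show "?P \<longlonglongrightarrow> 0"
    proof (rule real_tendsto_sandwich[where f = "\<lambda>_. 0"])
      show "\<forall>\<^sub>F n in sequentially. ?P n \<le> real n powr (-2/3) + (exp (1/2 * ln (real n) / real n) - 1)"
        using small log eventually_gt_at_top[of 0]
      proof eventually_elim
        case (elim n)
        have "p n * (real n)\<^sup>2 \<le> 3/4 * (real n)\<^sup>2" using elim by linarith
        then have p34: "p n \<le> 3/4"
          using elim(3) by (simp add: mult_le_cancel_right)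
        \<comment> \<open>The correlation factor is at most exp(n p), and \<open>small\<close>
          bounds n p by ln n / (2n), which tends to 0.\<close>
        have "(1 + p n) ^ n \<le> exp (p n) ^ n"
          using p[of n] by (intro power_mono) auto
        also have "\<dots> = exp (real n * p n)" by (simp add: exp_of_nat_mult)
        also have "\<dots> \<le> exp (1/2 * ln (real n) / real n)"
          using elim by (simp add: field_simps power2_eq_square)
        finally have 1: "(1 + p n) ^ n \<le> exp (1/2 * ln (real n) / real n)" .
        have "1 / expected_isolated n (p n) \<le> 1 / real n powr (2/3)"
          using expected_isolated_lower[OF p(1) p34 elim(1) elim(3)] elim(3) by (intro frac_le) auto
        also have "\<dots> = real n powr (-2/3)"
          using powr_minus_divide[of "real n" "2/3"] by simp
        finally show ?case using 1 prob_no_isolated_vertex_le[OF p elim(3), of n] by simp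
      qed
      show "(\<lambda>n. real n powr (-2/3) + (exp (1/2 * ln (real n) / real n) - 1)) \<longlonglongrightarrow> 0"
        by real_asymp
    qed auto
  next
    assume "(\<lambda>n. ln (real n) / (real n)\<^sup>2) \<in> o(p)"
    \<comment> \<open>The constant 1/12 yields the factor 12 in
      \<open>expected_isolated_upper\<close>.\<close>
    then have "\<forall>\<^sub>F n in sequentially. norm (ln (real n) / (real n)\<^sup>2) \<le> 1/12 * norm (p n)"
      by (rule landau_o.smallD) simp
    then have large: "\<forall>\<^sub>F n in sequentially. 12 * ln (real n) \<le> p n * (real n)\<^sup>2"
      using eventually_gt_at_top[of 0]
      by eventually_elim (use p in \<open>simp add: field_simps\<close>)
    show "?P \<longlonglongrightarrow> 1"
    proof (rule real_tendsto_sandwich[where h = "\<lambda>_. 1"])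
      show "\<forall>\<^sub>F n in sequentially. 1 - 1 / real n \<le> ?P n"
        using large eventually_ge_at_top[of 6]
      proof eventually_elim
        case (elim n)
        then show ?case
          using expected_isolated_upper[OF p elim(1)] prob_no_isolated_vertex_ge[OF p, of n n] by simp
      qed
      show "(\<lambda>n. 1 - 1 / real n) \<longlonglongrightarrow> 1" by real_asymp
    qed auto
  }
qed

end
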